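(* Let $\mathbb{F}$ be a field, let $\lambda_1,\dots,\lambda_q\in\mathbb{F}$ be distinct, let $m_1,\dots,m_q$ be positive integers, and put $d=m_1+\cdots+m_q$ and $\Lambda=\{\lambda_1^{(m_1)},\dots,\lambda_q^{(m_q)}\}$. Let $V_\Lambda\in\mathbb{F}^{d\times d}$ be the confluent Vandermonde matrix of $\Lambda$. Let $(\mu_1,\dots,\mu_d)$ be the sequence consisting of $\lambda_1$ repeated $m_1$ times, followed by $\lambda_2$ repeated $m_2$ times, and so on, ending with $\lambda_q$ repeated $m_q$ times, and define $p_k(x)=\prod_{i=1}^{k}(x-\mu_i)$ for $k=0,1,\dots,d-1$ (so $p_0(x)=1$). Let $W$ be the $d\times d$ matrix whose columns are, in order, the coefficient vectors $[p_0(x)],\dots,[p_{d-1}(x)]$, and let $L$ be the $d\times d$ matrix whose columns are, in order, $\operatorname{eval}_\Lambda(p_0(x)),\dots,\operatorname{eval}_\Lambda(p_{d-1}(x))$. Then $W$ is invertible, and with $U=W^{-1}$ one has $V_\Lambda U^{-1}=L$, where $L$ is lower triangular and $U$ is upper triangular; that is, $V_\Lambda=LU$ is an LU factorization of $V_\Lambda$.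
   Context: Hasse derivative: for a polynomial $p(x)=\sum_i c_i x^i\in\mathbb{F}[x]$ and an integer $r\ge 0$, $\mathcal{D}^{(r)}p(x)=\sum_{i\ge r} c_i\binom{i}{r}x^{i-r}$, where $\binom{i}{r}$ is interpreted as its image in $\mathbb{F}$; $\mathcal{D}^{(r)}p(\lambda)$ denotes its value at $x=\lambda$. Notation: $\Lambda=\{\lambda_1^{(m_1)},\dots,\lambda_q^{(m_q)}\}$ is the multiset in which the distinct element $\lambda_i$ has multiplicity $m_i$. Coefficient vector: for a polynomial $p(x)=c_0+c_1x+\cdots+c_{d-1}x^{d-1}$ of degree at most $d-1$, $[p(x)]=[c_0,\dots,c_{d-1}]^\top\in\mathbb{F}^d$. Evaluation vector: $\operatorname{eval}_\Lambda(p(x))\in\mathbb{F}^d$ is the column vector with entries, in order, $\mathcal{D}^{(0)}p(\lambda_1),\dots,\mathcal{D}^{(m_1-1)}p(\lambda_1),\ \dots,\ \mathcal{D}^{(0)}p(\lambda_q),\dots,\mathcal{D}^{(m_q-1)}p(\lambda_q)$. Confluent Vandermonde matrix: for $\lambda\in\mathbb{F}$ and $m\le d$, $V_{\lambda^{(m)}}^{(d)}$ is the $m\times d$ matrix whose entry in row $r$ and column $i$ ($0\le r\le m-1$, $0\le i\le d-1$) is $\binom{i}{r}\lambda^{i-r}$ if $i\ge r$ and $0$ if $i<r$ (with $\lambda^0=1$). The $d\times d$ matrix $V_\Lambda$ is obtained by stacking $V_{\lambda_1^{(m_1)}}^{(d)},\dots,V_{\lambda_q^{(m_q)}}^{(d)}$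 vertically in this order. Equivalently, $V_\Lambda[p(x)]=\operatorname{eval}_\Lambda(p(x))$ for every polynomial $p$ of degree at most $d-1$. *)

theory Defs
  imports
    "Jordan_Normal_Form.Gauss_Jordan_Elimination"
    "HOL-Computational_Algebra.Polynomial"
begin

text \<open>
  The multiset \<open>\<Lambda> = {\<lambda>\<^sub>1\<^bsup>(m\<^sub>1)\<^esup>, \<dots>, \<lambda>\<^sub>q\<^bsup>(m\<^sub>q)\<^esup>}\<close> is given by the list \<open>[(\<lambda>\<^sub>1, m\<^sub>1), \<dots>, (\<lambda>\<^sub>q, m\<^sub>q)]\<close>,
  since the order of the elements fixes the order of the rows below. Indices start at 0.
\<close>

definition hasse_deriv :: "nat \<Rightarrow> 'a::comm_semiring_1 poly \<Rightarrow> 'a poly" where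
  "hasse_deriv r p = (\<Sum>i = r..degree p. monom (coeff p i * of_nat (i choose r)) (i - r))"

text \<open>For \<open>degree p < d\<close> this is the coefficient vector; higher coefficients are cut off.\<close>

definition coeff_vec :: "nat \<Rightarrow> 'a::zero poly \<Rightarrow> 'a vec" where
  "coeff_vec d p = vec d (coeff p)"

definition eval_vec :: "('a::comm_semiring_1 \<times> nat) list \<Rightarrow> 'a poly \<Rightarrow> 'a vec" where
  "eval_vec \<Lambda> p =
     vec_of_list (concat (map (\<lambda>(l, m). map (\<lambda>r. poly (hasse_deriv r p) l) [0..<m]) \<Lambda>))"

definition confluent_block :: "nat \<Rightarrow> 'a::comm_semiring_1 \<Rightarrow> nat \<Rightarrow> 'a mat" where
  "confluent_block d l m =
     mat m d (\<lambda>(r, i). if r \<le> i then of_nat (i choose r) * l ^ (i - r) else 0)"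

definition confluent_vandermonde :: "('a::comm_semiring_1 \<times> nat) list \<Rightarrow> 'a mat" where
  "confluent_vandermonde \<Lambda> =
     (let d = sum_list (map snd \<Lambda>)
      in mat_of_rows d (concat (map (\<lambda>(l, m). rows (confluent_block d l m)) \<Lambda>)))"

definition lower_triangular :: "'a::zero mat \<Rightarrow> bool" where
  "lower_triangular A \<longleftrightarrow> (\<forall>i < dim_row A. \<forall>j < dim_col A. i < j \<longrightarrow> A $$ (i, j) = 0)"

text \<open>No normalisation of the diagonal of either factor is imposed.\<close>

definition lu_factorization :: "'a::semiring_0 mat \<Rightarrow> 'a mat \<Rightarrow> 'a mat \<Rightarrow> bool" where
  "lu_factorization A L U \<longleftrightarrow>
     (\<exists>n. A \<in> carrier_mat n n \<and> L \<in> carrier_mat n n \<and> U \<in> carrier_mat n n) \<and>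
     lower_triangular L \<and> upper_triangular U \<and> A = L * U"

lemma length_eval_list:
  "length (concat (map (\<lambda>(l, m). map (\<lambda>r. f r l) [0..<m]) \<Lambda>)) = sum_list (map snd \<Lambda>)"
  by (induction \<Lambda>) auto

lemma confluent_vandermonde_carrier:
  "confluent_vandermonde \<Lambda> \<in> carrier_mat (sum_list (map snd \<Lambda>)) (sum_list (map snd \<Lambda>))"
proof -
  have "length (concat (map (\<lambda>(l, m). rows (confluent_block d l m)) \<Lambda>)) = sum_list (map snd \<Lambda>)" for d
    by (induction \<Lambda>) (auto simp: confluent_block_def)
  then show ?thesis
    unfolding confluent_vandermonde_def Let_def by (metis mat_of_rows_carrier(1))
qed

lemma eval_vec_carrier: "eval_vec \<Lambda> p \<in> carrier_vec (sum_list (map snd \<Lambda>))"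
  unfolding eval_vec_def carrier_vec_def by (simp add: length_eval_list)

lemma confluent_block_mult:
  assumes "degree p < d" "r < m"
  shows "row (confluent_block d l m) r \<bullet> coeff_vec d p = poly (hasse_deriv r p) l"
proof -
  have "row (confluent_block d l m) r \<bullet> coeff_vec d p
      = (\<Sum>i = 0..<d. (if r \<le> i then of_nat (i choose r) * l ^ (i - r) else 0) * coeff p i)"
    using assms by (simp add: scalar_prod_def coeff_vec_def confluent_block_def)
  also have "\<dots> = (\<Sum>i = r..degree p. of_nat (i choose r) * l ^ (i - r) * coeff p i)"
    using assms by (intro sum.mono_neutral_cong_right) (auto simp: coeff_eq_0)
  also have "\<dots> = poly (hasse_deriv r p) l"
    by (simp add: hasse_deriv_def poly_sum poly_monom mult_ac)
  finally show ?thesis .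
qed

lemma confluent_vandermonde_mult:
  assumes "degree p < sum_list (map snd \<Lambda>)"
  shows "confluent_vandermonde \<Lambda> *\<^sub>v coeff_vec (sum_list (map snd \<Lambda>)) p = eval_vec \<Lambda> p"
proof -
  let ?d = "sum_list (map snd \<Lambda>)"
  have *: "map (\<lambda>v. v \<bullet> coeff_vec ?d p) (concat (map (\<lambda>(l, m). rows (confluent_block ?d l m)) xs))
      = concat (map (\<lambda>(l, m). map (\<lambda>r. poly (hasse_deriv r p) l) [0..<m]) xs)" for xs
  proof (induction xs)
    case (Cons x xs)
    obtain l m where x: "x = (l, m)" by (cases x)
    have "map (\<lambda>v. v \<bullet> coeff_vec ?d p) (rows (confluent_block ?d l m))
        = map (\<lambda>r. poly (hasse_deriv r p) l) [0..<m]"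
    proof -
      have "dim_row (confluent_block ?d l m) = m" by (simp add: confluent_block_def)
      then show ?thesis
        by (auto simp: rows_def confluent_block_mult[OF assms])
    qed
    with Cons show ?case by (simp add: x)
  qed simp
  have r: "set (concat (map (\<lambda>(l, m). rows (confluent_block ?d l m)) \<Lambda>)) \<subseteq> carrier_vec ?d"
    by (auto simp: rows_def confluent_block_def)
  let ?R = "concat (map (\<lambda>(l, m). rows (confluent_block ?d l m)) \<Lambda>)"
  have "confluent_vandermonde \<Lambda> *\<^sub>v coeff_vec ?d p = vec_of_list (map (\<lambda>v. v \<bullet> coeff_vec ?d p) ?R)"
  proof (rule eq_vecI)
    fix i assume i: "i < dim_vec (vec_of_list (map (\<lambda>v. v \<bullet> coeff_vec ?d p) ?R))"
    then have "i < length ?R" by (simp del: length_concat)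
    moreover from this r have "?R ! i \<in> carrier_vec ?d" by (meson nth_mem subsetD)
    ultimately show "(confluent_vandermonde \<Lambda> *\<^sub>v coeff_vec ?d p) $ i
        = vec_of_list (map (\<lambda>v. v \<bullet> coeff_vec ?d p) ?R) $ i"
      by (simp add: confluent_vandermonde_def Let_def vec_of_list_index del: length_concat)
  qed (simp add: confluent_vandermonde_def Let_def)
  then show ?thesis by (simp only: * eval_vec_def)
qed

end

theory Submission
  imports Defs "Jordan_Normal_Form.Determinant"
begin

text \<open>
  Substituting \<open>x + \<lambda>\<close> for \<open>x\<close> turns Hasse derivatives at \<open>\<lambda>\<close> into ordinary coefficients:
  \<open>\<D>\<^bsup>(r)\<^esup> p(\<lambda>)\<close> is the coefficient of \<open>x\<^sup>r\<close> in \<open>p(x + \<lambda>)\<close>. Hence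
  \<open>\<D>\<^bsup>(r)\<^esup> p(\<lambda>) = 0\<close> as soon as \<open>(x - \<lambda>)\<^bsup>r+1\<^esup>\<close> divides \<open>p\<close>, in every characteristic
  (\<open>poly_hasse_deriv_eq_0\<close>). Position \<open>i\<close> of an evaluation vector belongs to some pair \<open>(\<lambda>, r)\<close>,
  and the nodes \<open>\<mu>\<^sub>0, \<dots>, \<mu>\<^sub>i\<close> contain \<open>\<lambda>\<close> at least \<open>r + 1\<close> times (\<open>confluent_nodes_nth\<close>).
  Thus \<open>(x - \<lambda>)\<^bsup>r+1\<^esup>\<close> divides the Newton polynomial \<open>p\<^sub>k\<close> for all \<open>k > i\<close>, so entry \<open>(i, k)\<close>
  of \<open>L\<close> vanishes above the diagonal.

  The polynomial \<open>p\<^sub>k\<close> is monic of degree \<open>k\<close>, so \<open>W\<close> is upper triangular with ones on the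
  diagonal. It is therefore invertible, and its inverse \<open>U\<close> is again upper triangular
  (\<open>upper_triangular_left_inverse\<close>). Finally \<open>V W = L\<close> holds column by column, because \<open>V\<close>
  maps coefficient vectors to evaluation vectors, and multiplying by \<open>U\<close> from the right gives
  \<open>V = L U\<close>.
\<close>

text \<open>Hasse derivatives are the Taylor coefficients; this is the binomial theorem, monomial by
  monomial.\<close>

lemma poly_hasse_deriv_eq_coeff_pcompose:
  fixes p :: "'a::idom poly"
  shows "poly (hasse_deriv r p) l = coeff (pcompose p [:l, 1:]) r"
proof -
  have deg: "degree (map_poly (\<lambda>x. [:x:]) p) = degree p"
    by (rule degree_map_poly) simp
  have "coeff (pcompose p [:l, 1:]) r
      = (\<Sum>i\<le>degree p. coeff p i * coeff ([:l, 1:] ^ i) r)"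
    by (simp add: pcompose_altdef poly_altdef deg coeff_map_poly coeff_sum)
  also have "\<dots> = (\<Sum>i = r..degree p. coeff p i * coeff ([:l, 1:] ^ i) r)"
    by (rule sum.mono_neutral_right) (auto simp: coeff_eq_0 degree_power_eq)
  also have "\<dots> = (\<Sum>i = r..degree p. coeff p i * (of_nat (i choose r) * l ^ (i - r)))"
    by (intro sum.cong) (auto simp: coeff_linear_poly_power)
  also have "\<dots> = poly (hasse_deriv r p) l"
    by (simp add: hasse_deriv_def poly_sum poly_monom mult_ac)
  finally show ?thesis by simp
qed

lemma poly_hasse_deriv_eq_0:
  fixes p :: "'a::idom poly"
  assumes "[:- l, 1:] ^ n dvd p" and "r < n"
  shows "poly (hasse_deriv r p) l = 0"
proof -
  obtain q where q: "p = [:- l, 1:] ^ n * q" using assms(1) by (auto elim: dvdE)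
  have "pcompose [:- l, 1:] [:l, 1:] = [:0, 1:]" by (simp add: pcompose_pCons)
  then have "pcompose ([:- l, 1:] ^ n) [:l, 1:] = monom 1 n"
    by (induction n) (simp_all only: power_Suc power_0 pcompose_mult pcompose_1 monom_altdef smult_1_left)
  then have "pcompose p [:l, 1:] = monom 1 n * pcompose q [:l, 1:]"
    by (simp add: q pcompose_mult)
  then show ?thesis
    using assms(2) by (simp add: poly_hasse_deriv_eq_coeff_pcompose coeff_monom_mult)
qed

text \<open>Within the block of a node \<open>l\<close>, the entry of derivation order \<open>r\<close> sits at the
  position of the copy number \<open>r + 1\<close> of \<open>l\<close>. The function \<open>f\<close> stands for any quantity attached to a node and a derivation order, so that
  the lemma compares the layout of evaluation vectors with the layout of the list of nodes.\<close>

lemma confluent_nodes_nth: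
  assumes "i < sum_list (map snd \<Lambda>)"
  shows "\<exists>l r. concat (map (\<lambda>(l, m). map (\<lambda>r. f r l) [0..<m]) \<Lambda>) ! i = f r l \<and>
    r < count_list (take (Suc i) (concat (map (\<lambda>(l, m). replicate m l) \<Lambda>))) l"
  using assms
proof (induction \<Lambda> arbitrary: i)
  case (Cons x \<Lambda>)
  obtain l m where x: "x = (l, m)" by (cases x)
  show ?case
  proof (cases "i < m")
    case True
    then have "Suc i \<le> m" by simp
    then have "take (Suc i) (replicate m l) = replicate (Suc i) l" by (simp del: replicate_Suc)
    moreover have "count_list (replicate k l) l = k" for k by (induction k) auto
    ultimately show ?thesis
      using True by (intro exI[of _ l] exI[of _ i]) (simp add: x nth_append del: replicate_Suc)
  next
    case False
    then have "i - m < sum_list (map snd \<Lambda>)" using Cons.prems by (simp add: x)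
    from Cons.IH[OF this] False show ?thesis
      by (fastforce simp: x nth_append Suc_diff_le)
  qed
qed simp

lemma length_concat_replicate:
  "length (concat (map (\<lambda>(l, m). replicate m l) \<Lambda>)) = sum_list (map snd \<Lambda>)"
  by (induction \<Lambda>) auto

lemma linear_power_count_dvd_prod_list:
  fixes xs :: "'a::comm_ring_1 list"
  shows "[:- a, 1:] ^ count_list xs a dvd (\<Prod>x\<leftarrow>xs. [:- x, 1:])"
  by (induction xs) (auto intro: mult_dvd_mono dvd_mult simp del: mult_pCons_left)

lemma linear_power_dvd_prod_take:
  fixes \<mu> :: "'a::comm_ring_1 list"
  assumes "j \<le> k" and "k \<le> length \<mu>"
  shows "[:- a, 1:] ^ count_list (take j \<mu>) a dvd (\<Prod>i<k. [:- (\<mu> ! i), 1:])"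
proof -
  have "(\<Prod>i<n. [:- (\<mu> ! i), 1:]) = (\<Prod>x\<leftarrow>take n \<mu>. [:- x, 1:])" if "n \<le> length \<mu>" for n
    using that by (induction n) (auto simp: take_Suc_conv_app_nth mult.commute)
  moreover have "(\<Prod>i<j. [:- (\<mu> ! i), 1:]) dvd (\<Prod>i<k. [:- (\<mu> ! i), 1:])"
    using assms(1) by (intro prod_dvd_prod_subset) auto
  ultimately show ?thesis
    using linear_power_count_dvd_prod_list[of a "take j \<mu>"] assms dvd_trans by fastforce
qed

lemma degree_prod_linear:
  fixes a :: "nat \<Rightarrow> 'a::idom"
  shows "degree (\<Prod>i<k. [:- a i, 1:]) = k"
  by (simp add: degree_prod_eq_sum_degree)

lemma coeff_prod_linear:
  fixes a :: "nat \<Rightarrow> 'a::idom"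
  shows "coeff (\<Prod>i<k. [:- a i, 1:]) k = 1"
  using lead_coeff_prod[of "\<lambda>i. [:- a i, 1:]" "{..<k}"] by (simp add: degree_prod_linear)

text \<open>Below the diagonal, entry \<open>(i, j)\<close> of \<open>B A = 1\<close> reads
  \<open>\<Sum>\<^bsub>k \<le> j\<^esub> B\<^bsub>ik\<^esub> A\<^bsub>kj\<^esub> = 0\<close>. By induction on \<open>j\<close> only the term \<open>B\<^bsub>ij\<^esub> A\<^bsub>jj\<^esub>\<close>
  survives, and \<open>A\<^bsub>jj\<^esub>\<close> cancels.\<close>

lemma upper_triangular_left_inverse:
  fixes A B :: "'a::semidom mat"
  assumes A: "A \<in> carrier_mat n n" and B: "B \<in> carrier_mat n n"
    and ut: "upper_triangular A" and diag: "\<And>i. i < n \<Longrightarrow> A $$ (i, i) \<noteq> 0"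
    and BA: "B * A = 1\<^sub>m n"
  shows "upper_triangular B"
proof (rule upper_triangularI)
  fix i j :: nat
  assume "j < i" and "i < dim_row B"
  then have i: "i < n" using B by simp
  show "B $$ (i, j) = 0"
    using \<open>j < i\<close>
  proof (induction j rule: less_induct)
    case (less j)
    have "(B * A) $$ (i, j) = (\<Sum>k = 0..<n. B $$ (i, k) * A $$ (k, j))"
      using A B i less.prems by (simp add: scalar_prod_def)
    also have "\<dots> = (\<Sum>k\<in>{j}. B $$ (i, k) * A $$ (k, j))"
    proof (rule sum.mono_neutral_right)
      show "\<forall>k\<in>{0..<n} - {j}. B $$ (i, k) * A $$ (k, j) = 0"
      proof
        fix k assume k: "k \<in> {0..<n} - {j}"
        then consider "k < j" | "j < k" by fastforce
        then show "B $$ (i, k) * A $$ (k, j) = 0"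
          using less k A upper_triangularD[OF ut, of j k] by cases auto
      qed
    qed (use i less.prems in auto)
    finally have "B $$ (i, j) * A $$ (j, j) = 0"
      using i less.prems by (simp add: BA)
    then show ?case using diag[of j] i less.prems by simp
  qed
qed

text \<open>A right inverse forces \<open>det A \<noteq> 0\<close>, so Gauss--Jordan elimination returns a two-sided
  inverse \<open>C\<close>, and \<open>C = C (A B) = (C A) B = B\<close>.\<close>

lemma mat_inverse_eq_Some:
  fixes A B :: "'a::field mat"
  assumes A: "A \<in> carrier_mat n n" and B: "B \<in> carrier_mat n n" and AB: "A * B = 1\<^sub>m n"
  shows "mat_inverse A = Some B"
proof (cases "mat_inverse A")
  case None
  have "det A \<noteq> 0" using det_mult[OF A B] by (auto simp: AB)
  then have "A \<in> Units (ring_mat TYPE('a) n ())" by (rule det_non_zero_imp_unit[OF A])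
  then show ?thesis using mat_inverse(1)[OF A None, of "()"] by blast
next
  case (Some C)
  with mat_inverse(2)[OF A] have C: "C * A = 1\<^sub>m n" "C \<in> carrier_mat n n" by auto
  have "C = C * (A * B)" using C by (simp add: AB)
  also have "\<dots> = (C * A) * B" by (rule assoc_mult_mat[symmetric, OF C(2) A B])
  also have "\<dots> = B" using B by (simp add: C)
  finally show ?thesis using Some by simp
qed

theorem theorem4p1:
  fixes \<Lambda> :: "('a::field \<times> nat) list"
    and d :: nat and \<mu> :: "'a list" and p :: "nat \<Rightarrow> 'a poly" and W L :: "'a mat"
  assumes "distinct (map fst \<Lambda>)"
    and "\<forall>(l, m) \<in> set \<Lambda>. 0 < m"
    and "d = sum_list (map snd \<Lambda>)"
    and "\<mu> = concat (map (\<lambda>(l, m). replicate m l) \<Lambda>)"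
    and "\<forall>k < d. p k = (\<Prod>i<k. [:- (\<mu> ! i), 1:])"
    and "W = mat_of_cols d (map (\<lambda>k. coeff_vec d (p k)) [0..<d])"
    and "L = mat_of_cols d (map (\<lambda>k. eval_vec \<Lambda> (p k)) [0..<d])"
  shows "invertible_mat W \<and>
    (\<exists>U Uinv. mat_inverse W = Some U \<and> mat_inverse U = Some Uinv \<and>
       confluent_vandermonde \<Lambda> * Uinv = L \<and>
       lower_triangular L \<and> upper_triangular U \<and>
       lu_factorization (confluent_vandermonde \<Lambda>) L U)"
proof -
  let ?V = "confluent_vandermonde \<Lambda>"
  note d = assms(3) and \<mu> = assms(4) and W_def = assms(6) and L_def = assms(7)
  have p: "p k = (\<Prod>i<k. [:- (\<mu> ! i), 1:])" if "k < d" for k using assms(5) that by blast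
  have deg: "degree (p k) = k" if "k < d" for k by (simp add: p[OF that] degree_prod_linear)
  have len: "length \<mu> = d" by (simp only: \<mu> d length_concat_replicate)
  have V: "?V \<in> carrier_mat d d" unfolding d by (rule confluent_vandermonde_carrier)
  have W: "W \<in> carrier_mat d d" and L: "L \<in> carrier_mat d d"
    by (simp_all add: W_def L_def carrier_matI)

  have W_nth: "W $$ (i, k) = coeff (p k) i" if "i < d" "k < d" for i k
    using that by (simp add: W_def mat_of_cols_index coeff_vec_def)
  have W_ut: "upper_triangular W"
    using W by (intro upper_triangularI) (simp add: W_nth deg coeff_eq_0)
  have W_diag: "W $$ (i, i) = 1" if "i < d" for i
    using that by (simp add: W_nth p coeff_prod_linear)
  have "diag_mat W = replicate d 1"
    using W by (auto simp: diag_mat_def W_diag intro: nth_equalityI)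
  then have "det W = 1" by (simp add: det_upper_triangular[OF W_ut W])
  then have "W \<in> Units (ring_mat TYPE('a) d ())"
    by (intro det_non_zero_imp_unit[OF W]) simp
  then obtain U where U_inv: "mat_inverse W = Some U"
    using mat_inverse(1)[OF W, of "()"] by fastforce
  then have WU: "W * U = 1\<^sub>m d" and UW: "U * W = 1\<^sub>m d" and U: "U \<in> carrier_mat d d"
    using mat_inverse(2)[OF W] by auto
  have W_inv: "mat_inverse U = Some W" by (rule mat_inverse_eq_Some[OF U W UW])
  have W_invertible: "invertible_mat W"
    using W U WU UW by (auto simp: invertible_mat_def inverts_mat_def)
  have U_ut: "upper_triangular U"
    by (rule upper_triangular_left_inverse[OF W U W_ut _ UW]) (simp add: W_diag)

  have VW: "?V * W = L"
  proof (rule mat_col_eqI)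
    fix k assume "k < dim_col L"
    then have k: "k < d" using L by simp
    have "col (?V * W) k = ?V *\<^sub>v coeff_vec d (p k)"
      using V W k by (simp add: W_def coeff_vec_def)
    also have "\<dots> = eval_vec \<Lambda> (p k)"
      using confluent_vandermonde_mult[of "p k" \<Lambda>] k by (simp add: deg d)
    also have "\<dots> = col L k"
      using k eval_vec_carrier[of \<Lambda> "p k"] by (simp add: L_def d)
    finally show "col (?V * W) k = col L k" .
  qed (use V W L in auto)

  have L_lt: "lower_triangular L"
    unfolding lower_triangular_def
  proof (intro allI impI)
    fix i k assume "i < dim_row L" "k < dim_col L" and ik: "i < k"
    then have i: "i < d" and k: "k < d" using L by auto
    let ?f = "\<lambda>r l. poly (hasse_deriv r (p k)) l"
    obtain l r where
      nth: "concat (map (\<lambda>(l, m). map (\<lambda>r. ?f r l) [0..<m]) \<Lambda>) ! i = ?f r l" and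
      r: "r < count_list (take (Suc i) \<mu>) l"
      using confluent_nodes_nth[of i \<Lambda> ?f] i unfolding \<mu> d by blast
    have "[:- l, 1:] ^ count_list (take (Suc i) \<mu>) l dvd p k"
      unfolding p[OF k] by (rule linear_power_dvd_prod_take) (use ik k len in auto)
    from poly_hasse_deriv_eq_0[OF this r] show "L $$ (i, k) = 0"
      using i k nth by (simp add: L_def mat_of_cols_index eval_vec_def vec_of_list_index)
  qed

  have "L * U = ?V * (W * U)"
    unfolding VW[symmetric] by (rule assoc_mult_mat[OF V W U])
  then have "?V = L * U" using V by (simp add: WU)
  then have "lu_factorization ?V L U"
    using V L U L_lt U_ut unfolding lu_factorization_def by blast
  then show ?thesis
    using W_invertible U_inv W_inv VW L_lt U_ut by blast
qed

end
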